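(* Let $A$ be a $\mathbb Z$-graded complex vector space and let $m=m_1+m_2+\cdots$ be a formal sum of multilinear maps $m_k:A^{\otimes k}\to A$ ($k\ge 1$) with $(-1)^{|m_k|}=(-1)^k$ for all $k$. Let $l_n(a_1,\dots,a_n)=\sum_{\sigma\in S_n}(-1)^{p(\sigma;a_1,\dots,a_n)}m_n(a_{\sigma(1)},\dots,a_{\sigma(n)})$ be the super antisymmetrization of $m_n$. Then the following two families of identities are equivalent: (i) for all $n\ge1$ and all homogeneous $a_1,\dots,a_n\in A$, $$\sum_{i+j=n+1}\ \sum_{\sigma}(-1)^{p(\sigma;a_1,\dots,a_n)+i}\; l_i\big(l_j(a_{\sigma(1)},\dots,a_{\sigma(j)}),a_{\sigma(j+1)},\dots,a_{\sigma(n)}\big)=0,$$ where $i,j\ge1$ and $\sigma$ runs through all permutations in $S_n$ with $\sigma(1)<\cdots<\sigma(j)$ and $\sigma(j+1)<\cdots<\sigma(n)$; (ii) for all $n\ge1$ and all homogeneous $a_1,\dots,a_n\in A$, $$\{\tilde m\circ\tilde m\}\{sa_1\}\{sa_2\}\cdots\{sa_n\}=0 .$$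
   Context: For homogeneous $a\in A$, $|a|$ is its degree (super degree) and $\|a\|=|a|-1$ its suspended degree. A multilinear map $x:A^{\otimes n}\to A$ has super degree $|x|$ if $|x(a_1,\dots,a_n)|=|a_1|+\cdots+|a_n|+|x|$ for all homogeneous $a_i$; only the parity of $|m_k|$ matters here. For $\sigma\in S_n$ and homogeneous $a_1,\dots,a_n$: $$p(\sigma;a_1,\dots,a_n)=\sum_{u<v,\ \sigma^{-1}(u)>\sigma^{-1}(v)}(1+|a_u||a_v|),\qquad \tilde e(\sigma;a_1,\dots,a_n)=\sum_{u<v,\ \sigma^{-1}(u)>\sigma^{-1}(v)}\|a_u\|\,\|a_v\| .$$ Modified maps (suspension operator suppressed; values are regarded as elements of $A$): $\tilde m_n(a_1,\dots,a_n)=(-1)^{\sum_{t=1}^n(n-t)\|a_t\|}\,m_n(a_1,\dots,a_n)$, and $\tilde m=\tilde m_1+\tilde m_2+\cdots$. The $n$-linear component of $\tilde m\circ\tilde m$ is $$(\tilde m\circ\tilde m)(a_1,\dots,a_n)=\sum_{i+j=n+1}\sum_{k=0}^{i-1}(-1)^{\|a_1\|+\cdots+\|a_k\|}\;\tilde m_i\big(a_1,\dots,a_k,\tilde m_j(a_{k+1},\dots,a_{k+j}),a_{k+j+1},\dots,a_n\big),\quad i,j\ge1$$ (the sign is $(-1)^{\|m_j\|(\|a_1\|+\cdots+\|a_k\|)}$ with $\|m_j\|=|m_j|+j-1$, which is odd). The expression in separate braces denotes suspended-graded symmetrization: $$\{\tilde m\circ\tilde m\}\{sa_1\}\cdots\{sa_n\}=\sum_{\sigma\in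 S_n}(-1)^{\tilde e(\sigma;a_1,\dots,a_n)}\,(\tilde m\circ\tilde m)(a_{\sigma(1)},\dots,a_{\sigma(n)}).$$ *)

theory Defs
  imports Complex_Main "HOL-Combinatorics.Permutations"
begin

text \<open>Tuples \<open>(a_1, \<dots>, a_n)\<close> are lists of length \<open>n\<close>, and \<open>S_n\<close> is the set of
  permutations of \<open>{..<n}\<close>; all positions are shifted down by one accordingly.
  The tuple \<open>(a_\<sigma>(1), \<dots>, a_\<sigma>(n))\<close> is \<^term>\<open>permute_list \<sigma> as\<close>.
  An \<open>n\<close>-ary map is a function on lists of which only the values on lists of
  length \<open>n\<close> matter.\<close>

locale graded_vector_space = vector_space scale
  for scale :: "complex \<Rightarrow> 'a::ab_group_add \<Rightarrow> 'a" +
  fixes G :: "int \<Rightarrow> 'a set"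
  assumes subspace_component: "subspace (G i)"
    and direct_sum: "\<exists>!f. (\<forall>i. f i \<in> G i) \<and> finite {i. f i \<noteq> 0} \<and> x = (\<Sum>i | f i \<noteq> 0. f i)"

definition multilinear :: "(complex \<Rightarrow> 'a \<Rightarrow> 'a) \<Rightarrow> nat \<Rightarrow> ('a list \<Rightarrow> 'a::ab_group_add) \<Rightarrow> bool" where
  "multilinear scale n f \<longleftrightarrow>
     (\<forall>as t. length as = n \<and> t < n \<longrightarrow> Vector_Spaces.linear scale scale (\<lambda>x. f (as[t := x])))"

definition homogeneous :: "(int \<Rightarrow> 'a set) \<Rightarrow> 'a \<Rightarrow> bool" where
  "homogeneous G a \<longleftrightarrow> (\<exists>i. a \<in> G i)"

text \<open>The zero vector is homogeneous of every degree. Here it is assigned degree \<open>0\<close>; the choice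
  is immaterial since every multilinear expression with a zero argument vanishes.\<close>

definition hdeg :: "(int \<Rightarrow> 'a set) \<Rightarrow> 'a::zero \<Rightarrow> int" where
  "hdeg G a = (if a = 0 then 0 else (THE i. a \<in> G i))"

definition sdeg :: "(int \<Rightarrow> 'a set) \<Rightarrow> 'a::zero \<Rightarrow> int" where
  "sdeg G a = hdeg G a - 1"

text \<open>Membership in the component, rather than an equation between degrees, allows the value to
  be zero.\<close>

definition has_super_degree :: "(int \<Rightarrow> 'a set) \<Rightarrow> nat \<Rightarrow> ('a list \<Rightarrow> 'a::zero) \<Rightarrow> int \<Rightarrow> bool" where
  "has_super_degree G n f d \<longleftrightarrow>
     (\<forall>as. length as = n \<and> (\<forall>a\<in>set as. homogeneous G a) \<longrightarrow>
        f as \<in> G ((\<Sum>t<n. hdeg G (as ! t)) + d))"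

definition inversions :: "nat \<Rightarrow> (nat \<Rightarrow> nat) \<Rightarrow> (nat \<times> nat) set" where
  "inversions n \<sigma> = {(u, v). u < v \<and> v < n \<and> inv \<sigma> u > inv \<sigma> v}"

definition p_sgn :: "(int \<Rightarrow> 'a set) \<Rightarrow> (nat \<Rightarrow> nat) \<Rightarrow> 'a::zero list \<Rightarrow> int" where
  "p_sgn G \<sigma> as =
     (\<Sum>(u, v)\<in>inversions (length as) \<sigma>. 1 + hdeg G (as ! u) * hdeg G (as ! v))"

definition e_sgn :: "(int \<Rightarrow> 'a set) \<Rightarrow> (nat \<Rightarrow> nat) \<Rightarrow> 'a::zero list \<Rightarrow> int" where
  "e_sgn G \<sigma> as =
     (\<Sum>(u, v)\<in>inversions (length as) \<sigma>. sdeg G (as ! u) * sdeg G (as ! v))"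

definition super_antisym ::
    "(complex \<Rightarrow> 'a \<Rightarrow> 'a) \<Rightarrow> (int \<Rightarrow> 'a set) \<Rightarrow> (nat \<Rightarrow> 'a list \<Rightarrow> 'a) \<Rightarrow> nat \<Rightarrow> 'a list \<Rightarrow> 'a::ab_group_add" where
  "super_antisym scale G m n as =
     (\<Sum>\<sigma> | \<sigma> permutes {..<n}. scale ((-1) powi p_sgn G \<sigma> as) (m n (permute_list \<sigma> as)))"

definition unshuffles :: "nat \<Rightarrow> nat \<Rightarrow> (nat \<Rightarrow> nat) set" where
  "unshuffles j n =
     {\<sigma>. \<sigma> permutes {..<n} \<and> strict_mono_on {..<j} \<sigma> \<and> strict_mono_on {j..<n} \<sigma>}"

definition tilde ::
    "(complex \<Rightarrow> 'a \<Rightarrow> 'a) \<Rightarrow> (int \<Rightarrow> 'a set) \<Rightarrow> (nat \<Rightarrow> 'a list \<Rightarrow> 'a) \<Rightarrow> nat \<Rightarrow> 'a list \<Rightarrow> 'a::zero" where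
  "tilde scale G m n as =
     scale ((-1) powi (\<Sum>t<n. int (n - Suc t) * sdeg G (as ! t))) (m n as)"

text \<open>The component of \<open>M \<circ> M\<close> of arity \<open>n\<close>, for \<open>M = M_1 + M_2 + \<dots>\<close> with all \<open>M_j\<close> odd with
  respect to the suspended degree.\<close>

definition self_comp ::
    "(complex \<Rightarrow> 'a \<Rightarrow> 'a) \<Rightarrow> (int \<Rightarrow> 'a set) \<Rightarrow> (nat \<Rightarrow> 'a list \<Rightarrow> 'a) \<Rightarrow> nat \<Rightarrow> 'a list \<Rightarrow> 'a::ab_group_add" where
  "self_comp scale G M n as =
     (\<Sum>(i, j) | 1 \<le> i \<and> 1 \<le> j \<and> i + j = n + 1.
        \<Sum>k<i. scale ((-1) powi (\<Sum>t<k. sdeg G (as ! t)))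
                 (M i (take k as @ [M j (take j (drop k as))] @ drop (k + j) as)))"

definition susp_sym ::
    "(complex \<Rightarrow> 'a \<Rightarrow> 'a) \<Rightarrow> (int \<Rightarrow> 'a set) \<Rightarrow> (nat \<Rightarrow> 'a list \<Rightarrow> 'a) \<Rightarrow> nat \<Rightarrow> 'a list \<Rightarrow> 'a::ab_group_add" where
  "susp_sym scale G f n as =
     (\<Sum>\<sigma> | \<sigma> permutes {..<n}. scale ((-1) powi e_sgn G \<sigma> as) (f n (permute_list \<sigma> as)))"

end

theory Submission
  imports Defs "HOL-Combinatorics.Multiset_Permutations"
begin

text \<open>For every \<open>n\<close> and every tuple the two expressions agree up to a sign. Both expand into a sum over
  the words \<open>u v z\<close> in the indices, with \<open>v\<close> of length \<open>j\<close>, of the terms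
  \<open>m_i(a_u, m_j(a_v), a_z)\<close>: in (i), an unshuffle together with the permutations in \<open>l_j\<close> and \<open>l_i\<close>
  determines \<open>v\<close>, the word \<open>u z\<close>, and the slot of \<open>l_j\<close> among the arguments of \<open>l_i\<close>; in (ii) the
  word is the permutation itself. The two signs differ by \<open>-(-1)^E\<close>, where
  \<open>E = \<Sum>_t (n - t) \<parallel>a_t\<parallel>\<close> depends only on the tuple.\<close>

text \<open>The factor (-1)^E is the decalage sign between antisymmetrizing \<open>m n\<close> and
  symmetrizing \<open>tilde scale G m n\<close> in suspended degrees; the extra minus sign is the 1
  in i = |u| + |z| + 1. Two obstacles shape the argument. A tuple may repeat a vector, so a
  permutation cannot be recovered from the permuted tuple: the words therefore consist of indices,
  and vectors enter only through a map \<open>g\<close>. Moreover the sign of the outer operation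
  involves the degree of an inner value, and an inner value that is zero has \<open>hdeg\<close> 0
  by convention, possibly of the wrong parity. All exponents are therefore written with the formal
  degree D, the sum of the degrees of the letters of v plus \<open>d j\<close>, and a zero inner
  value is treated apart, since the whole term then vanishes. As D depends only on the set of
  letters of v, the whole sum l_j lies in one component, and the outer sign can be evaluated before
  l_j is expanded by linearity.\<close>

section \<open>Weighted inversions of words\<close>

text \<open>With weight 1 + |a||b| or \<parallel>a\<parallel> \<parallel>b\<parallel> this is p or
  the suspended exponent of a permutation, read off from the permuted word. Unlike a formula through
  \<open>inv \<sigma>\<close>, it splits along concatenations of words.\<close>

primrec inv_sum :: "('i::linorder \<Rightarrow> 'i \<Rightarrow> int) \<Rightarrow> 'i list \<Rightarrow> int" where
  "inv_sum c [] = 0"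
| "inv_sum c (x # w) = (\<Sum>y\<in>set w. if y < x then c x y else 0) + inv_sum c w"

text \<open>The blocks are sets because the inversions between two adjacent blocks do not depend on
  the order inside either block.\<close>

definition cross_sum :: "('i::linorder \<Rightarrow> 'i \<Rightarrow> int) \<Rightarrow> 'i set \<Rightarrow> 'i set \<Rightarrow> int" where
  "cross_sum c A B = (\<Sum>x\<in>A. \<Sum>y\<in>B. if y < x then c x y else 0)"

lemma inv_sum_append:
  assumes "distinct (u @ v)"
  shows "inv_sum c (u @ v) = inv_sum c u + inv_sum c v + cross_sum c (set u) (set v)"
  using assms
  by (induction u) (auto simp: cross_sum_def sum.union_disjoint)

lemma inv_sum_sorted: "sorted_wrt (<) w \<Longrightarrow> inv_sum c w = 0"
proof (induction w)
  case (Cons x w)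
  then have "(\<Sum>y\<in>set w. if y < x then c x y else 0) = 0"
    by (intro sum.neutral) (auto simp: not_less less_imp_le)
  with Cons show ?case by simp
qed simp

lemma inv_sum_cong:
  assumes "\<And>x y. x \<in> set w \<Longrightarrow> y \<in> set w \<Longrightarrow> c x y = c' x y"
  shows "inv_sum c w = inv_sum c' w"
  using assms by (induction w) (auto intro!: sum.cong)

text \<open>A pair of letters from disjoint blocks is inverted in exactly one of the two block
  orders. This gives the cost of moving one block past another.\<close>

lemma cross_sum_add_swap:
  assumes sym: "\<And>x y. c x y = c y x" and "A \<inter> B = {}"
  shows "cross_sum c A B + cross_sum c B A = (\<Sum>x\<in>A. \<Sum>y\<in>B. c x y)"
proof -
  have "cross_sum c B A = (\<Sum>x\<in>A. \<Sum>y\<in>B. if x < y then c y x else 0)"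
    unfolding cross_sum_def by (rule sum.swap)
  then show ?thesis
    unfolding cross_sum_def using assms(2)
    by (auto simp flip: sum.distrib simp: sym intro!: sum.cong)
qed

lemma inv_sum_conv_nth:
  assumes "distinct w"
  shows "inv_sum c w = (\<Sum>p<length w. \<Sum>q<length w. if p < q \<and> w ! q < w ! p then c (w ! p) (w ! q) else 0)"
  using assms
proof (induction w)
  case (Cons x w)
  have "(\<Sum>y\<in>set w. if y < x then c x y else 0) = (\<Sum>q<length w. if w ! q < x then c x (w ! q) else 0)"
    using Cons.prems
    by (intro sum.reindex_bij_betw[symmetric] bij_betw_nth) auto
  with Cons show ?case
    by (simp add: sum.lessThan_Suc_shift del: sum.lessThan_Suc cong: if_cong)
qed simp

text \<open>An element of \<open>inversions\<close> is a pair of values whose positions in the word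
  are reversed; substituting v = \<sigma> p and u = \<sigma> q turns it into a pair of positions p <
  q. Symmetry of \<open>c\<close> is used because \<open>inversions\<close> lists the smaller letter
  first and \<open>inv_sum\<close> the larger one.\<close>

lemma sum_inversions:
  fixes xs :: "'i::linorder list"
  assumes \<sigma>: "\<sigma> permutes {..<length xs}" and xs: "sorted_wrt (<) xs"
    and sym: "\<And>x y. c x y = c y x"
  shows "(\<Sum>(u, v)\<in>inversions (length xs) \<sigma>. c (xs ! u) (xs ! v)) = inv_sum c (permute_list \<sigma> xs)"
proof -
  let ?n = "length xs"
  have lt: "xs ! a < xs ! b \<longleftrightarrow> a < b" if "a < ?n" "b < ?n" for a b
    using sorted_wrt_nth_less[OF xs] that by (metis linorder_neqE not_less_iff_gr_or_eq)
  have s: "\<sigma> p < ?n" if "p < ?n" for p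
    using permutes_in_image[OF \<sigma>] that by blast
  have "(\<Sum>(u, v)\<in>inversions ?n \<sigma>. c (xs ! u) (xs ! v)) =
      (\<Sum>(u, v)\<in>{..<?n} \<times> {..<?n}. if u < v \<and> inv \<sigma> v < inv \<sigma> u then c (xs ! u) (xs ! v) else 0)"
    by (rule sum.mono_neutral_cong_left) (auto simp: inversions_def split: if_splits)
  also have "\<dots> = (\<Sum>u<?n. \<Sum>v<?n. if u < v \<and> inv \<sigma> v < inv \<sigma> u then c (xs ! u) (xs ! v) else 0)"
    by (simp add: sum.cartesian_product)
  also have "\<dots> = (\<Sum>v<?n. \<Sum>u<?n. if u < v \<and> inv \<sigma> v < inv \<sigma> u then c (xs ! u) (xs ! v) else 0)"
    by (rule sum.swap)
  also have "\<dots> = (\<Sum>p<?n. \<Sum>u<?n. if u < \<sigma> p \<and> p < inv \<sigma> u then c (xs ! u) (xs ! \<sigma> p) else 0)"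
    by (subst sum.permute[OF \<sigma>]) (simp add: permutes_inverses[OF \<sigma>])
  also have "\<dots> = (\<Sum>p<?n. \<Sum>q<?n. if \<sigma> q < \<sigma> p \<and> p < q then c (xs ! \<sigma> q) (xs ! \<sigma> p) else 0)"
    by (subst sum.permute[OF \<sigma>]) (simp add: permutes_inverses[OF \<sigma>])
  also have "\<dots> = inv_sum c (permute_list \<sigma> xs)"
    using \<sigma> xs
    by (subst inv_sum_conv_nth)
       (auto simp: strict_sorted_iff permute_list_nth[OF \<sigma>] lt s sym intro!: sum.cong)
  finally show ?thesis .
qed

section \<open>Sums over permutations as sums over words\<close>

lemma bij_betw_permute_list:
  assumes "distinct xs"
  shows "bij_betw (\<lambda>\<sigma>. permute_list \<sigma> xs) {\<sigma>. \<sigma> permutes {..<length xs}} (permutations_of_set (set xs))"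
proof (rule bij_betw_imageI)
  show "inj_on (\<lambda>\<sigma>. permute_list \<sigma> xs) {\<sigma>. \<sigma> permutes {..<length xs}}"
  proof (rule inj_onI, clarify)
    fix \<sigma> \<tau> assume \<sigma>: "\<sigma> permutes {..<length xs}" and \<tau>: "\<tau> permutes {..<length xs}"
      and eq: "permute_list \<sigma> xs = permute_list \<tau> xs"
    show "\<sigma> = \<tau>"
    proof
      fix p show "\<sigma> p = \<tau> p"
      proof (cases "p < length xs")
        case True
        then have "\<sigma> p < length xs" "\<tau> p < length xs"
          using permutes_in_image[OF \<sigma>] permutes_in_image[OF \<tau>] by blast+
        moreover have "xs ! \<sigma> p = xs ! \<tau> p"
          using eq True by (metis \<sigma> \<tau> permute_list_nth)
        ultimately show ?thesis using assms nth_eq_iff_index_eq by blast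
      next
        case False
        then show ?thesis using permutes_not_in[OF \<sigma>] permutes_not_in[OF \<tau>] by simp
      qed
    qed
  qed
  show "(\<lambda>\<sigma>. permute_list \<sigma> xs) ` {\<sigma>. \<sigma> permutes {..<length xs}} = permutations_of_set (set xs)"
  proof (intro equalityI subsetI)
    fix w assume "w \<in> permutations_of_set (set xs)"
    then have "mset w = mset xs"
      using assms by (metis permutations_of_setD set_eq_iff_mset_eq_distinct)
    then obtain \<sigma> where "\<sigma> permutes {..<length xs}" "permute_list \<sigma> xs = w"
      using mset_eq_permutation by metis
    then show "w \<in> (\<lambda>\<sigma>. permute_list \<sigma> xs) ` {\<sigma>. \<sigma> permutes {..<length xs}}" by blast
  qed (use assms in \<open>auto intro!: permutations_of_setI\<close>)
qed

lemma sum_permutes_permute_list: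
  assumes "distinct xs"
  shows "(\<Sum>\<sigma> | \<sigma> permutes {..<length xs}. F (permute_list \<sigma> xs)) = (\<Sum>w\<in>permutations_of_set (set xs). F w)"
  using sum.reindex_bij_betw[OF bij_betw_permute_list[OF assms]] by simp

text \<open>Since \<open>xs\<close> is increasing, \<sigma> increases on a block of positions
  exactly when the letters of the word increase there.\<close>

lemma sum_unshuffles:
  fixes xs :: "'i::linorder list"
  assumes xs: "sorted_wrt (<) xs" and j: "j \<le> length xs"
  shows "(\<Sum>\<sigma>\<in>unshuffles j (length xs). F (permute_list \<sigma> xs)) =
    (\<Sum>w | w \<in> permutations_of_set (set xs) \<and> sorted_wrt (<) (take j w) \<and> sorted_wrt (<) (drop j w). F w)"
proof -
  let ?n = "length xs" and ?Q = "\<lambda>w. sorted_wrt (<) (take j w) \<and> sorted_wrt (<) (drop j w)"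
  have lt: "xs ! a < xs ! b \<longleftrightarrow> a < b" if "a < ?n" "b < ?n" for a b
    using sorted_wrt_nth_less[OF xs] that by (metis linorder_neqE not_less_iff_gr_or_eq)
  have Q: "strict_mono_on {..<j} \<sigma> \<and> strict_mono_on {j..<?n} \<sigma> \<longleftrightarrow> ?Q (permute_list \<sigma> xs)"
    if \<sigma>: "\<sigma> permutes {..<?n}" for \<sigma>
  proof -
    have s: "\<sigma> p < ?n" if "p < ?n" for p
      using permutes_in_image[OF \<sigma>] that by blast
    have "strict_mono_on {..<j} \<sigma> \<longleftrightarrow> sorted_wrt (<) (take j (permute_list \<sigma> xs))"
      using j by (auto simp: sorted_wrt_iff_nth_less strict_mono_on_def permute_list_nth[OF \<sigma>] lt s)
    moreover have "strict_mono_on {j..<?n} \<sigma> \<longleftrightarrow> sorted_wrt (<) (drop j (permute_list \<sigma> xs))"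
    proof -
      have "sorted_wrt (<) (drop j (permute_list \<sigma> xs)) \<longleftrightarrow>
          (\<forall>p q. p < q \<longrightarrow> q < ?n - j \<longrightarrow> \<sigma> (j + p) < \<sigma> (j + q))"
        using j by (auto simp: sorted_wrt_iff_nth_less permute_list_nth[OF \<sigma>] lt s)
      also have "\<dots> \<longleftrightarrow> strict_mono_on {j..<?n} \<sigma>"
      proof
        assume *: "\<forall>p q. p < q \<longrightarrow> q < ?n - j \<longrightarrow> \<sigma> (j + p) < \<sigma> (j + q)"
        show "strict_mono_on {j..<?n} \<sigma>"
        proof (rule strict_mono_onI)
          fix r t assume "r \<in> {j..<?n}" "t \<in> {j..<?n}" "r < t"
          then show "\<sigma> r < \<sigma> t"
            using *[rule_format, of "r - j" "t - j"] by auto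
        qed
      next
        assume *: "strict_mono_on {j..<?n} \<sigma>"
        show "\<forall>p q. p < q \<longrightarrow> q < ?n - j \<longrightarrow> \<sigma> (j + p) < \<sigma> (j + q)"
          using j by (intro allI impI strict_mono_onD[OF *]) auto
      qed
      finally show ?thesis by simp
    qed
    ultimately show ?thesis by simp
  qed
  have "(\<Sum>\<sigma>\<in>unshuffles j ?n. F (permute_list \<sigma> xs)) =
      (\<Sum>\<sigma>\<in>{\<sigma> \<in> {\<sigma>. \<sigma> permutes {..<?n}}. ?Q (permute_list \<sigma> xs)}. F (permute_list \<sigma> xs))"
    by (rule sum.cong) (use Q in \<open>auto simp: unshuffles_def\<close>)
  also have "\<dots> = (\<Sum>\<sigma> | \<sigma> permutes {..<?n}. if ?Q (permute_list \<sigma> xs) then F (permute_list \<sigma> xs) else 0)"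
    by (rule sum.inter_filter) (simp add: finite_permutations)
  also have "\<dots> = (\<Sum>w\<in>permutations_of_set (set xs). if ?Q w then F w else 0)"
    using xs by (intro sum_permutes_permute_list) (simp add: strict_sorted_iff)
  also have "\<dots> = (\<Sum>w\<in>{w \<in> permutations_of_set (set xs). ?Q w}. F w)"
    by (rule sum.inter_filter[symmetric]) simp
  finally show ?thesis by simp
qed

text \<open>Rearranging both blocks of an unshuffle yields every word exactly once: the cut after
  \<open>j\<close> letters returns the two rearranged blocks, and sorting each of them returns the
  unshuffle.\<close>

lemma sum_unshuffle_words:
  fixes I :: "'i::linorder set"
  assumes I: "finite I"
  shows "(\<Sum>w | w \<in> permutations_of_set I \<and> sorted_wrt (<) (take j w) \<and> sorted_wrt (<) (drop j w).
      \<Sum>v\<in>permutations_of_set (set (take j w)). \<Sum>y\<in>permutations_of_set (set (drop j w)). F v y)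
    = (\<Sum>w\<in>permutations_of_set I. F (take j w) (drop j w))"
proof -
  let ?W = "{w. w \<in> permutations_of_set I \<and> sorted_wrt (<) (take j w) \<and> sorted_wrt (<) (drop j w)}"
  let ?P = "\<lambda>w. permutations_of_set (set (take j w)) \<times> permutations_of_set (set (drop j w))"
  let ?s = "\<lambda>w. sorted_list_of_set (set w)"
  have fin: "finite ?W"
    using I by (auto intro: finite_subset[of _ "permutations_of_set I"])
  \<comment> \<open>The length is compared with that of \<open>take j w\<close> and not with
    \<open>j\<close>, because \<open>j\<close> may exceed the size of \<open>I\<close>; the second
    block is empty in that case.\<close>
  have len: "length (take j w) = length v"
    if "v \<in> permutations_of_set (set (take j w))" "w \<in> permutations_of_set I" for v w
    using that by (metis distinct_card distinct_take permutations_of_setD)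
  have lens: "length (?s (take j w)) = length (take j w)" if "w \<in> permutations_of_set I" for w
    using that by (simp add: permutations_of_setD distinct_card)
  have "(\<Sum>w\<in>?W. \<Sum>v\<in>permutations_of_set (set (take j w)). \<Sum>y\<in>permutations_of_set (set (drop j w)). F v y)
      = (\<Sum>(w, v, y)\<in>Sigma ?W ?P. F v y)"
    using fin by (simp add: sum.cartesian_product sum.Sigma split_def)
  also have "\<dots> = (\<Sum>w\<in>permutations_of_set I. F (take j w) (drop j w))"
  proof (rule sum.reindex_bij_witness[where j = "\<lambda>(w, v, y). v @ y"
        and i = "\<lambda>w. (?s (take j w) @ ?s (drop j w), take j w, drop j w)"], goal_cases)
    case (1 a)
    obtain w v y where a: "a = (w, v, y)" by (cases a)
    have w: "w \<in> permutations_of_set I" "sorted_wrt (<) (take j w)" "sorted_wrt (<) (drop j w)"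
      and v: "v \<in> permutations_of_set (set (take j w))" and y: "y \<in> permutations_of_set (set (drop j w))"
      using 1 a by auto
    have sv: "set v = set (take j w)" and sy: "set y = set (drop j w)"
      using v y by (auto dest: permutations_of_setD)
    have "take j (v @ y) = v" "drop j (v @ y) = y"
      using len[OF v w(1)] y by (auto simp: min_def split: if_splits)
    moreover have "?s v = take j w" "?s y = drop j w"
      using w unfolding sv sy by (simp_all add: sorted_list_of_set.idem_if_sorted_distinct strict_sorted_iff)
    ultimately show ?case by (simp add: a)
  next
    case (2 a)
    obtain w v y where a: "a = (w, v, y)" by (cases a)
    have w: "w \<in> permutations_of_set I"
      and v: "v \<in> permutations_of_set (set (take j w))" and y: "y \<in> permutations_of_set (set (drop j w))"
      using 2 a by auto
    have "set v \<inter> set y = {}"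
      using w v y by (simp add: permutations_of_setD set_take_disj_set_drop_if_distinct)
    moreover have "set v \<union> set y = I"
      using w v y by (metis append_take_drop_id permutations_of_setD(1) set_append)
    ultimately show ?case using v y by (auto simp: a permutations_of_set_def)
  next
    case (3 w)
    then show ?case by simp
  next
    case (4 w)
    have d: "set (take j w) \<inter> set (drop j w) = {}"
      using 4 by (simp add: permutations_of_setD set_take_disj_set_drop_if_distinct)
    have u: "set (take j w) \<union> set (drop j w) = I"
      using 4 by (metis append_take_drop_id permutations_of_setD(1) set_append)
    define w' where "w' = ?s (take j w) @ ?s (drop j w)"
    have t: "take j w' = ?s (take j w)" "drop j w' = ?s (drop j w)"
      unfolding w'_def using lens[OF 4] by (auto simp: min_def split: if_splits)
    have "w' \<in> permutations_of_set I"
      unfolding w'_def using d u by (intro permutations_of_setI) auto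
    moreover have "take j w \<in> permutations_of_set (set (take j w))" "drop j w \<in> permutations_of_set (set (drop j w))"
      using 4 by (auto intro!: permutations_of_setI dest: permutations_of_setD)
    ultimately show ?case by (simp add: t flip: w'_def)
  next
    case (5 a)
    obtain w v y where a: "a = (w, v, y)" by (cases a)
    have w: "w \<in> permutations_of_set I"
      and v: "v \<in> permutations_of_set (set (take j w))" and y: "y \<in> permutations_of_set (set (drop j w))"
      using 5 a by auto
    have "take j (v @ y) = v" "drop j (v @ y) = y"
      using len[OF v w(1)] y by (auto simp: min_def split: if_splits)
    then show ?case by (simp add: a)
  qed
  finally show ?thesis .
qed

text \<open>A word containing \<open>x\<close> is the same as the rest of the word together with the
  number \<open>k\<close> of letters before \<open>x\<close>. For the arguments of l_i,
  \<open>x\<close> is the inner value and \<open>k\<close> becomes the slot of the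
  composition.\<close>

lemma sum_words_insert:
  assumes Y: "finite Y" and x: "x \<notin> Y"
  shows "(\<Sum>w\<in>permutations_of_set (insert x Y). F w) =
    (\<Sum>k<Suc (card Y). \<Sum>y\<in>permutations_of_set Y. F (take k y @ x # drop k y))"
proof -
  have "(\<Sum>k<Suc (card Y). \<Sum>y\<in>permutations_of_set Y. F (take k y @ x # drop k y)) =
      (\<Sum>(k, y)\<in>{..<Suc (card Y)} \<times> permutations_of_set Y. F (take k y @ x # drop k y))"
    by (simp only: sum.cartesian_product)
  also have "\<dots> = (\<Sum>w\<in>permutations_of_set (insert x Y). F w)"
  proof (rule sum.reindex_bij_witness[where j = "\<lambda>(k, y). take k y @ x # drop k y"
        and i = "\<lambda>w. (length (takeWhile (\<lambda>z. z \<noteq> x) w), filter (\<lambda>z. z \<noteq> x) w)"], goal_cases)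
    case (1 a)
    obtain k y where a: "a = (k, y)" by (cases a)
    have k: "k \<le> card Y" and y: "distinct y" "set y = Y"
      using 1 unfolding a by (auto dest: permutations_of_setD)
    have *: "z \<noteq> x" if "z \<in> set (take k y) \<or> z \<in> set (drop k y)" for z
      using that x y by (auto dest: in_set_takeD in_set_dropD)
    have "k \<le> length y" using k y distinct_card by fastforce
    moreover have "filter (\<lambda>z. z \<noteq> x) (take k y) = take k y" "filter (\<lambda>z. z \<noteq> x) (drop k y) = drop k y"
      using * by (auto simp: filter_id_conv)
    moreover have "takeWhile (\<lambda>z. z \<noteq> x) (take k y @ x # drop k y) = take k y"
      using * by (simp add: takeWhile_tail)
    ultimately show ?case by (simp add: a)
  next
    case (2 a)
    obtain k y where a: "a = (k, y)" by (cases a)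
    have y: "distinct y" "set y = Y"
      using 2 unfolding a by (auto dest: permutations_of_setD)
    have "set (take k y) \<union> set (drop k y) = Y" using y by (metis append_take_drop_id set_append)
    moreover have "set (take k y) \<inter> set (drop k y) = {}"
      using y by (simp add: set_take_disj_set_drop_if_distinct)
    ultimately show ?case using x y by (auto simp: a permutations_of_set_def)
  next
    case (3 w)
    then have "x \<in> set w" "distinct w" by (auto dest: permutations_of_setD)
    then obtain u z where w: "w = u @ x # z" "x \<notin> set u" "x \<notin> set z"
      by (metis distinct.simps(2) distinct_append split_list_first)
    then have "filter (\<lambda>z. z \<noteq> x) u = u" "filter (\<lambda>z. z \<noteq> x) z = z" "takeWhile (\<lambda>z. z \<noteq> x) w = u"
      by (auto simp: filter_id_conv takeWhile_tail)
    with w show ?case by simp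
  next
    case (4 w)
    then have w: "x \<in> set w" "distinct w" "set w = insert x Y" by (auto dest: permutations_of_setD)
    have "length w = Suc (card Y)" using w Y x by (metis card_insert_disjoint distinct_card)
    moreover have "length (takeWhile (\<lambda>z. z \<noteq> x) w) < length w"
      using w(1) by (induction w) auto
    ultimately show ?case using w x by (auto simp: permutations_of_set_def)
  next
    case (5 a)
    then show ?case by auto
  qed
  finally show ?thesis by simp
qed

text \<open>Expanding l_i and l_j produces words v u z, because l_j is the first argument of l_i,
  whereas the composition in (ii) reads u v z. For a fixed slot \<open>k\<close> the exchange of the
  blocks u and v is a bijection of words.\<close>

lemma sum_words_rotate:
  assumes kj: "k + j \<le> card I"
  shows "(\<Sum>w\<in>permutations_of_set I. F (take j w) (drop j w)) =
    (\<Sum>w\<in>permutations_of_set I. F (take j (drop k w)) (take k w @ drop (k + j) w))"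
proof -
  \<comment> \<open>\<open>r a b\<close> exchanges the first \<open>a\<close> letters with the next
    \<open>b\<close>; on words of length at least a + b its inverse is \<open>r b a\<close>.\<close>
  define r where "r a b w = take b (drop a w) @ take a w @ drop (a + b) w" for a b and w :: "'a list"
  have cut: "take a w @ take b (drop a w) @ drop (a + b) w = w" for a b and w :: "'a list"
    by (metis add.commute append_take_drop_id drop_drop)
  have r: "r a b w \<in> permutations_of_set I" if "w \<in> permutations_of_set I" for a b w
  proof -
    have "mset (r a b w) = mset (take a w @ take b (drop a w) @ drop (a + b) w)"
      by (simp add: r_def)
    also have "\<dots> = mset w" by (simp only: cut)
    finally show ?thesis
      using that by (metis mset_eq_imp_distinct_iff permutations_of_setD permutations_of_setI set_mset_mset)
  qed
  have t: "take b (r a b w) = take b (drop a w)" "take a (drop b (r a b w)) = take a w"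
      "drop b (r a b w) = take a w @ drop (a + b) w" "drop (b + a) (r a b w) = drop (a + b) w"
      if "w \<in> permutations_of_set I" "a + b \<le> card I" for a b w
  proof -
    have "a + b \<le> length w"
      using that by (metis distinct_card permutations_of_setD)
    then show "take b (r a b w) = take b (drop a w)" "take a (drop b (r a b w)) = take a w"
      "drop b (r a b w) = take a w @ drop (a + b) w" "drop (b + a) (r a b w) = drop (a + b) w"
      by (auto simp: r_def)
  qed
  have rr: "r b a (r a b w) = w" if "w \<in> permutations_of_set I" "a + b \<le> card I" for a b w
    by (simp only: r_def[of b a] t(1,2,4)[OF that] cut)
  have jk: "j + k \<le> card I" using kj by simp
  show ?thesis
  proof (rule sum.reindex_bij_witness[where j = "r j k" and i = "r k j"], goal_cases)
    case (1 w)
    then show ?case by (rule rr[OF _ jk])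
  next
    case (2 w)
    then show ?case by (rule r)
  next
    case (3 w)
    then show ?case by (rule rr[OF _ kj])
  next
    case (4 w)
    then show ?case by (rule r)
  next
    case (5 w)
    have "take k (r j k w) @ drop (k + j) (r j k w) = drop j w"
      unfolding t[OF 5 jk] by (metis add.commute append_take_drop_id drop_drop)
    then show ?case using t(2)[OF 5 jk] by simp
  qed
qed

section \<open>Signs: inversion sums and suspension weights modulo 2\<close>

lemma cross_sum_Un_right:
  assumes "finite B" "finite C" "B \<inter> C = {}"
  shows "cross_sum c A (B \<union> C) = cross_sum c A B + cross_sum c A C"
  using assms by (simp add: cross_sum_def sum.union_disjoint sum.distrib)

text \<open>The least letter is inverted with precisely the letters in front of it. It models the
  inner value, which is the first argument of l_i and so precedes all others in the original
  order.\<close>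

lemma inv_sum_insert_least:
  assumes "distinct (u @ z)" and a: "\<And>x. x \<in> set (u @ z) \<Longrightarrow> a < x"
  shows "inv_sum c (u @ a # z) = inv_sum c (u @ z) + (\<Sum>x\<in>set u. c x a)"
proof -
  have "a \<notin> set (u @ z)" using a by blast
  moreover have "\<not> y < a" if "y \<in> set z" for y
    using a[of y] that by auto
  then have "inv_sum c (a # z) = inv_sum c z"
    by simp
  moreover have "cross_sum c (set u) (set (a # z)) = cross_sum c (set u) (set z) + (\<Sum>x\<in>set u. c x a)"
    using a \<open>a \<notin> set (u @ z)\<close> by (simp add: cross_sum_def sum.distrib)
  ultimately show ?thesis
    using assms(1) inv_sum_append[of u "a # z" c] inv_sum_append[of u z c] by auto
qed

text \<open>This is the exponent in \<open>tilde\<close>. It takes a list of degrees and not of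
  vectors, so that the formal value D - 1 can stand in the slot of an inner value even if that value
  is zero.\<close>

primrec susp_weight :: "int list \<Rightarrow> int" where
  "susp_weight [] = 0"
| "susp_weight (x # xs) = int (length xs) * x + susp_weight xs"

lemma susp_weight_conv_nth: "(\<Sum>t<length xs. int (length xs - Suc t) * xs ! t) = susp_weight xs"
  by (induction xs) (simp_all add: sum.lessThan_Suc_shift del: sum.lessThan_Suc)

lemma susp_weight_append:
  "susp_weight (xs @ ys) = susp_weight xs + int (length ys) * sum_list xs + susp_weight ys"
  by (induction xs) (simp_all add: algebra_simps)

text \<open>Modulo 2, the exponents \<open>1 + |a||b|\<close> and \<open>\<parallel>a\<parallel> \<parallel>b\<parallel>\<close> of an inversion differ by
  \<open>\<parallel>a\<parallel> + \<parallel>b\<parallel>\<close>. Adding \<^const>\<open>susp_weight\<close> leaves one copy of \<open>\<parallel>a\<parallel>\<close> for the smaller index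
  of every pair, which depends on the set of letters only.\<close>

lemma inv_sum_desuspend_aux:
  fixes s :: "'i::linorder \<Rightarrow> int"
  assumes "distinct w"
  shows "even (inv_sum (\<lambda>x y. 1 + (s x + 1) * (s y + 1)) w + inv_sum (\<lambda>x y. s x * s y) w
    + susp_weight (map s w) + (\<Sum>x\<in>set w. \<Sum>y\<in>set w. if x < y then s x else 0))"
  using assms
proof (induction w)
  case (Cons x w)
  let ?H = "\<lambda>X. \<Sum>x\<in>X. \<Sum>y\<in>X. if x < y then s x else 0"
  have H: "?H (set (x # w)) = ?H (set w) + (\<Sum>y\<in>set w. (if x < y then s x else 0) + (if y < x then s y else 0))"
    using Cons.prems by (simp add: sum.distrib)
  \<comment> \<open>The weight of the leading letter is distributed over the letters after it, one
    copy of \<open>s x\<close> for each, so that parity can be checked separately for every pair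
    consisting of \<open>x\<close> and a later \<open>y\<close>.\<close>
  have len: "int (length w) * s x = (\<Sum>y\<in>set w. s x)"
    using Cons.prems by (simp add: distinct_card)
  have A: "even (\<Sum>y\<in>set w. (if y < x then 1 + (s x + 1) * (s y + 1) else 0) + (if y < x then s x * s y else 0)
      + s x + ((if x < y then s x else 0) + (if y < x then s y else 0)))"
  proof (rule dvd_sum)
    fix y assume "y \<in> set w"
    then have "x < y \<or> y < x" using Cons.prems by (metis distinct.simps(2) linorder_neqE)
    then show "even ((if y < x then 1 + (s x + 1) * (s y + 1) else 0) + (if y < x then s x * s y else 0)
      + s x + ((if x < y then s x else 0) + (if y < x then s y else 0)))"
      by (auto dest: order.asym)
  qed
  have B: "even (inv_sum (\<lambda>x y. 1 + (s x + 1) * (s y + 1)) w + inv_sum (\<lambda>x y. s x * s y) w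
    + susp_weight (map s w) + ?H (set w))"
    using Cons by simp
  have eq: "inv_sum (\<lambda>x y. 1 + (s x + 1) * (s y + 1)) (x # w) + inv_sum (\<lambda>x y. s x * s y) (x # w)
      + susp_weight (map s (x # w)) + ?H (set (x # w))
    = (\<Sum>y\<in>set w. (if y < x then 1 + (s x + 1) * (s y + 1) else 0) + (if y < x then s x * s y else 0)
      + s x + ((if x < y then s x else 0) + (if y < x then s y else 0)))
      + (inv_sum (\<lambda>x y. 1 + (s x + 1) * (s y + 1)) w + inv_sum (\<lambda>x y. s x * s y) w
      + susp_weight (map s w) + ?H (set w))"
    unfolding H inv_sum.simps susp_weight.simps list.map length_map len sum.distrib by linarith
  show ?case unfolding eq by (rule dvd_add[OF A B])
qed simp

text \<open>The double sum in the preceding congruence depends only on the set of letters. It is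
  evaluated by applying that congruence to \<open>xs\<close> itself, which has no inversions, and
  the result is the decalage sign.\<close>

lemma inv_sum_desuspend:
  fixes s :: "'i::linorder \<Rightarrow> int"
  assumes w: "distinct w" and xs: "sorted_wrt (<) xs" and eq: "set w = set xs"
  shows "even (inv_sum (\<lambda>x y. 1 + (s x + 1) * (s y + 1)) w + inv_sum (\<lambda>x y. s x * s y) w
    + susp_weight (map s w) + susp_weight (map s xs))"
proof -
  let ?H = "\<Sum>x\<in>set xs. \<Sum>y\<in>set xs. if x < y then s x else 0"
  have A: "even (susp_weight (map s xs) + ?H)"
    using inv_sum_desuspend_aux[of xs s] xs by (simp add: inv_sum_sorted strict_sorted_iff)
  have B: "even (inv_sum (\<lambda>x y. 1 + (s x + 1) * (s y + 1)) w + inv_sum (\<lambda>x y. s x * s y) w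
    + susp_weight (map s w) + ?H)"
    using inv_sum_desuspend_aux[OF w, of s] unfolding eq .
  have cancel: "even (c + a)" if "even (a + b)" "even (c + b)" for a b c :: int
    using that by presburger
  show ?thesis by (rule cancel[OF A B])
qed

text \<open>Write S_u for the sum of \<open>s\<close> over u, and l for the length of z. Because D
  is congruent to S_v modulo 2, moving v past u and the inner value past u together contribute |u| +
  j S_u to the exponent of (i), and adding i leaves j S_u + l + 1. In (ii), the sign of the
  composition and the two weights amount to the weight of u v z plus j S_u + l. The common part
  cancels, and \<open>inv_sum_desuspend\<close> for the word u v z accounts for the rest.\<close>

lemma sign_parity:
  fixes s :: "'i::linorder \<Rightarrow> int" and j :: nat
  defines "h \<equiv> \<lambda>x. s x + 1"
  assumes dist: "distinct (u @ v @ z)" and xs: "sorted_wrt (<) xs" and eq: "set (u @ v @ z) = set xs"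
    and j: "length v = j" and i: "i = Suc (length u + length z)" and dj: "even (dj + int j)"
    and D: "D = (\<Sum>x\<in>set v. h x) + dj"
  shows "even (cross_sum (\<lambda>x y. 1 + h x * h y) (set v) (set (u @ z)) + int i
      + inv_sum (\<lambda>x y. 1 + h x * h y) v + inv_sum (\<lambda>x y. 1 + h x * h y) (u @ z)
      + (\<Sum>x\<in>set u. 1 + h x * D)
      + (inv_sum (\<lambda>x y. s x * s y) (u @ v @ z) + (\<Sum>x\<in>set u. s x)
        + susp_weight (map s u @ (D - 1) # map s z) + susp_weight (map s v))
      + 1 + susp_weight (map s xs))"
proof -
  let ?c = "\<lambda>x y. 1 + h x * h y"
  let ?S = "\<lambda>X. \<Sum>x\<in>X. s x"
  let ?k = "int (length u)" and ?l = "int (length z)"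
  have Hv: "(\<Sum>x\<in>set v. h x) = ?S (set v) + int j"
    using dist j by (simp add: h_def sum.distrib distinct_card)
  have sl: "sum_list (map s u) = ?S (set u)" "sum_list (map s v) = ?S (set v)"
    using dist by (simp_all add: sum_list_distinct_conv_sum_set)
  have "cross_sum ?c (set u) (set v) + cross_sum ?c (set v) (set u) = (\<Sum>x\<in>set u. \<Sum>y\<in>set v. ?c x y)"
    using dist by (intro cross_sum_add_swap) (auto simp: mult.commute)
  also have "\<dots> = (\<Sum>x\<in>set u. int j + h x * (\<Sum>y\<in>set v. h y))"
    using dist j by (simp add: sum.distrib sum_distrib_left distinct_card)
  also have "\<dots> = ?k * int j + (?S (set u) + ?k) * (?S (set v) + int j)"
    unfolding Hv using dist by (simp add: sum.distrib h_def distinct_card flip: sum_distrib_right)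
  finally have swap: "cross_sum ?c (set u) (set v) + cross_sum ?c (set v) (set u) =
      ?k * int j + (?S (set u) + ?k) * (?S (set v) + int j)" .
  have D': "D = ?S (set v) + int j + dj" by (simp add: D Hv)
  have sumD: "(\<Sum>x\<in>set u. 1 + h x * D) = ?k + (?S (set u) + ?k) * D"
    using dist by (simp add: sum.distrib h_def distinct_card flip: sum_distrib_right)
  have vuz: "cross_sum ?c (set v) (set (u @ z)) = cross_sum ?c (set v) (set u) + cross_sum ?c (set v) (set z)"
    using dist by (auto intro!: cross_sum_Un_right)
  have uvz: "inv_sum ?c (u @ v @ z) = inv_sum ?c u + inv_sum ?c v + inv_sum ?c z
      + cross_sum ?c (set v) (set z) + cross_sum ?c (set u) (set v) + cross_sum ?c (set u) (set z)"
  proof -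
    have "cross_sum ?c (set u) (set (v @ z)) = cross_sum ?c (set u) (set v) + cross_sum ?c (set u) (set z)"
      using dist by (auto intro!: cross_sum_Un_right)
    then show ?thesis
      using dist inv_sum_append[of u "v @ z" ?c] inv_sum_append[of v z ?c] by auto
  qed
  have uz: "inv_sum ?c (u @ z) = inv_sum ?c u + inv_sum ?c z + cross_sum ?c (set u) (set z)"
    using dist by (intro inv_sum_append) auto
  have w1: "susp_weight (map s (u @ v @ z)) = susp_weight (map s u) + (int j + ?l) * ?S (set u)
      + susp_weight (map s v) + ?l * ?S (set v) + susp_weight (map s z)"
    using j by (simp add: susp_weight_append sl)
  have w2: "susp_weight (map s u @ (D - 1) # map s z) = susp_weight (map s u) + (1 + ?l) * ?S (set u)
      + ?l * (D - 1) + susp_weight (map s z)"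
    by (simp add: susp_weight_append sl)
  \<comment> \<open>This is where the parity of |m_j| enters: it turns D into S_v + 2q, that is, the
    inner map is even up to the shift by j and D may be replaced by S_v.\<close>
  obtain q where q: "dj = 2 * q - int j"
    using dj by (metis add_diff_cancel_right' evenE)
  have "even (inv_sum ?c (u @ v @ z) + inv_sum (\<lambda>x y. s x * s y) (u @ v @ z)
    + susp_weight (map s (u @ v @ z)) + susp_weight (map s xs))"
    using inv_sum_desuspend[OF dist xs eq] unfolding h_def .
  then obtain e where e: "inv_sum ?c (u @ v @ z) + inv_sum (\<lambda>x y. s x * s y) (u @ v @ z)
    + susp_weight (map s (u @ v @ z)) + susp_weight (map s xs) = 2 * e" by (elim evenE)
  \<comment> \<open>Half of the total exponent, obtained by collecting terms after all
    substitutions; only its being an integer matters.\<close>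
  let ?w = "?k + 1 + e + ?S (set u) + ?l * q + ?k * int j + (?S (set u) + ?k) * (?S (set v) + q)
    - cross_sum ?c (set u) (set v)"
  have "cross_sum ?c (set v) (set (u @ z)) + int i + inv_sum ?c v + inv_sum ?c (u @ z) + (\<Sum>x\<in>set u. 1 + h x * D)
      + (inv_sum (\<lambda>x y. s x * s y) (u @ v @ z) + ?S (set u)
        + susp_weight (map s u @ (D - 1) # map s z) + susp_weight (map s v))
      + 1 + susp_weight (map s xs) = 2 * ?w"
  proof -
    have i': "int i = ?k + ?l + 1" using i by simp
    have X: "cross_sum ?c (set v) (set u) = ?k * int j + (?S (set u) + ?k) * (?S (set v) + int j)
        - cross_sum ?c (set u) (set v)"
      using swap by linarith
    have eps: "inv_sum (\<lambda>x y. s x * s y) (u @ v @ z) = 2 * e - inv_sum ?c (u @ v @ z)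
        - susp_weight (map s (u @ v @ z)) - susp_weight (map s xs)"
      using e by linarith
    have Dq: "D = ?S (set v) + 2 * q" using D' q by linarith
    show ?thesis
      unfolding i' vuz X sumD uz eps uvz w1 w2 unfolding Dq by (simp add: algebra_simps)
  qed
  then show ?thesis by (metis dvd_triv_left)
qed

lemma minus_one_powi_cong: "even (a + b) \<Longrightarrow> (-1 :: complex) powi a = (-1) powi b"
  by (auto simp: power_int_minus_left)

section \<open>Degrees, multilinearity and the expansion of l_n over words\<close>

locale graded_multilinear_maps = graded_vector_space scale G
  for scale :: "complex \<Rightarrow> 'a::ab_group_add \<Rightarrow> 'a" and G :: "int \<Rightarrow> 'a set" +
  fixes m :: "nat \<Rightarrow> 'a list \<Rightarrow> 'a" and d :: "nat \<Rightarrow> int"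
  assumes multilinear: "k \<ge> 1 \<Longrightarrow> multilinear scale k (m k)"
    and degree: "k \<ge> 1 \<Longrightarrow> has_super_degree G k (m k) (d k)"
    and parity: "k \<ge> 1 \<Longrightarrow> (-1 :: complex) powi d k = (-1) ^ k"
begin

text \<open>If a nonzero \<open>x\<close> lay in two components, the families concentrated in either
  degree would be two decompositions of \<open>x\<close>, contradicting uniqueness in
  \<open>direct_sum\<close>.\<close>

lemma hdeg_eq:
  assumes "x \<in> G i" "x \<noteq> 0"
  shows "hdeg G x = i"
proof -
  have "k = i" if k: "x \<in> G k" for k
  proof -
    let ?f = "\<lambda>a l. if l = a then x else 0"
    let ?decomp = "\<lambda>f. (\<forall>l. f l \<in> G l) \<and> finite {l. f l \<noteq> 0} \<and> x = (\<Sum>l | f l \<noteq> 0. f l)"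
    have *: "?decomp (?f a)" if "x \<in> G a" for a
    proof -
      have "{l. ?f a l \<noteq> 0} = {a}" using assms(2) by auto
      then show ?thesis using that subspace_0[OF subspace_component] by simp
    qed
    have "(THE f. ?decomp f) = ?f a" if "x \<in> G a" for a
      by (rule the1_equality[OF direct_sum]) (rule *[OF that])
    from this[OF assms(1)] this[OF k] have "?f i = ?f k" by (rule trans[OF sym])
    then have "?f i k = ?f k k" by (rule fun_cong)
    then show ?thesis using assms(2) by (simp split: if_splits)
  qed
  then have "(THE i. x \<in> G i) = i" using assms(1) by (intro the_equality)
  then show ?thesis using assms(2) by (simp add: hdeg_def)
qed

lemma sdeg_eq: "x \<in> G i \<Longrightarrow> x \<noteq> 0 \<Longrightarrow> sdeg G x = i - 1"
  by (simp add: sdeg_def hdeg_eq)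

lemma even_degree: "k \<ge> 1 \<Longrightarrow> even (d k + int k)"
  using parity[of k] by (auto simp: power_int_minus_left minus_one_power_iff split: if_splits)

text \<open>Linearity in one slot, in the form needed to expand an inner l_j; the empty sum and a
  one-term sum give the cases of zero and of a scalar multiple.\<close>

lemma map_slot_sum:
  assumes "i = Suc (length us + length zs)"
  shows "m i (us @ (\<Sum>v\<in>V. scale (c v) (f v)) # zs) = (\<Sum>v\<in>V. scale (c v) (m i (us @ f v # zs)))"
proof -
  have "Vector_Spaces.linear scale scale (\<lambda>x. m i ((us @ 0 # zs)[length us := x]))"
    using multilinear[of i, unfolded multilinear_def, rule_format, of "us @ 0 # zs" "length us"] assms
    by simp
  then interpret lin: Vector_Spaces.linear scale scale "\<lambda>x. m i (us @ x # zs)"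
    by simp
  show ?thesis by (simp add: lin.sum lin.scale)
qed

lemma map_slot_zero: "i = Suc (length us + length zs) \<Longrightarrow> m i (us @ 0 # zs) = 0"
  using map_slot_sum[of i us zs "\<lambda>_. 0" "\<lambda>_. 0" "{}"] by simp

lemma map_slot_scale:
  "i = Suc (length us + length zs) \<Longrightarrow> m i (us @ scale c x # zs) = scale c (m i (us @ x # zs))"
  using map_slot_sum[of i us zs "\<lambda>_. c" "\<lambda>_. x" "{()}"] by simp

lemma map_in_component:
  assumes "distinct w" "w \<noteq> []" "length w = j" and hom: "\<forall>x\<in>set w. homogeneous G (g x)"
  shows "m j (map g w) \<in> G ((\<Sum>x\<in>set w. hdeg G (g x)) + d j)"
proof -
  have j: "j \<ge> 1" using assms by (cases w) auto
  have "(\<Sum>t<j. hdeg G (map g w ! t)) = (\<Sum>t<j. hdeg G (g (w ! t)))"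
    using assms(3) by simp
  also have "\<dots> = (\<Sum>x\<in>set w. hdeg G (g x))"
    using assms by (intro sum.reindex_bij_betw bij_betw_nth) auto
  finally show ?thesis
    using degree[OF j, unfolded has_super_degree_def, rule_format, of "map g w"] assms by auto
qed

abbreviation anti_exp :: "(nat \<Rightarrow> 'a) \<Rightarrow> nat list \<Rightarrow> int" where
  "anti_exp g \<equiv> inv_sum (\<lambda>x y. 1 + hdeg G (g x) * hdeg G (g y))"

abbreviation susp_exp :: "(nat \<Rightarrow> 'a) \<Rightarrow> nat list \<Rightarrow> int" where
  "susp_exp g \<equiv> inv_sum (\<lambda>x y. sdeg G (g x) * sdeg G (g y))"

lemma p_sgn_word:
  assumes "\<sigma> permutes {..<length xs}" "sorted_wrt (<) xs"
  shows "p_sgn G \<sigma> (map g xs) = anti_exp g (permute_list \<sigma> xs)"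
proof -
  have "p_sgn G \<sigma> (map g xs) =
      (\<Sum>(u, v)\<in>inversions (length xs) \<sigma>. 1 + hdeg G (g (xs ! u)) * hdeg G (g (xs ! v)))"
    unfolding p_sgn_def length_map by (rule sum.cong) (auto simp: inversions_def)
  also have "\<dots> = anti_exp g (permute_list \<sigma> xs)"
    by (rule sum_inversions[OF assms]) (simp add: mult.commute)
  finally show ?thesis .
qed

lemma e_sgn_word:
  assumes "\<sigma> permutes {..<length xs}" "sorted_wrt (<) xs"
  shows "e_sgn G \<sigma> (map g xs) = susp_exp g (permute_list \<sigma> xs)"
proof -
  have "e_sgn G \<sigma> (map g xs) =
      (\<Sum>(u, v)\<in>inversions (length xs) \<sigma>. sdeg G (g (xs ! u)) * sdeg G (g (xs ! v)))"
    unfolding e_sgn_def length_map by (rule sum.cong) (auto simp: inversions_def)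
  also have "\<dots> = susp_exp g (permute_list \<sigma> xs)"
    by (rule sum_inversions[OF assms]) (simp add: mult.commute)
  finally show ?thesis .
qed

lemma super_antisym_words:
  assumes xs: "sorted_wrt (<) xs"
  shows "super_antisym scale G m (length xs) (map g xs) =
    (\<Sum>w\<in>permutations_of_set (set xs). scale ((-1) powi anti_exp g w) (m (length xs) (map g w)))"
proof -
  have "super_antisym scale G m (length xs) (map g xs) = (\<Sum>\<sigma> | \<sigma> permutes {..<length xs}.
      scale ((-1) powi anti_exp g (permute_list \<sigma> xs)) (m (length xs) (map g (permute_list \<sigma> xs))))"
    unfolding super_antisym_def
    by (rule sum.cong) (simp_all add: p_sgn_word[OF _ xs] permute_list_map)
  also have "\<dots> = (\<Sum>w\<in>permutations_of_set (set xs). scale ((-1) powi anti_exp g w) (m (length xs) (map g w)))"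
    using xs by (intro sum_permutes_permute_list) (simp add: strict_sorted_iff)
  finally show ?thesis .
qed

lemma susp_sym_words:
  assumes xs: "sorted_wrt (<) xs"
  shows "susp_sym scale G f (length xs) (map g xs) =
    (\<Sum>w\<in>permutations_of_set (set xs). scale ((-1) powi susp_exp g w) (f (length xs) (map g w)))"
proof -
  have "susp_sym scale G f (length xs) (map g xs) = (\<Sum>\<sigma> | \<sigma> permutes {..<length xs}.
      scale ((-1) powi susp_exp g (permute_list \<sigma> xs)) (f (length xs) (map g (permute_list \<sigma> xs))))"
    unfolding susp_sym_def
    by (rule sum.cong) (simp_all add: e_sgn_word[OF _ xs] permute_list_map)
  also have "\<dots> = (\<Sum>w\<in>permutations_of_set (set xs). scale ((-1) powi susp_exp g w) (f (length xs) (map g w)))"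
    using xs by (intro sum_permutes_permute_list) (simp add: strict_sorted_iff)
  finally show ?thesis .
qed

text \<open>All summands of l_j use the same letters, hence have the same degree. The sign of the
  outer antisymmetrization needs this degree of the inner value.\<close>

lemma super_antisym_in_component:
  fixes g :: "nat \<Rightarrow> 'a"
  assumes xs: "sorted_wrt (<) xs" "xs \<noteq> []" and hom: "\<forall>x\<in>set xs. homogeneous G (g x)"
  shows "super_antisym scale G m (length xs) (map g xs) \<in> G ((\<Sum>x\<in>set xs. hdeg G (g x)) + d (length xs))"
  unfolding super_antisym_words[OF xs(1)]
proof (intro subspace_sum subspace_scale subspace_component)
  fix w assume "w \<in> permutations_of_set (set xs)"
  then have w: "distinct w" "set w = set xs" by (auto dest: permutations_of_setD)
  have "distinct xs" using xs by (simp add: strict_sorted_iff)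
  with w have "length w = length xs" by (metis distinct_card)
  moreover have "w \<noteq> []" using w xs(2) by auto
  ultimately have "m (length xs) (map g w) \<in> G ((\<Sum>x\<in>set w. hdeg G (g x)) + d (length xs))"
    using w hom by (intro map_in_component) auto
  then show "m (length xs) (map g w) \<in> G ((\<Sum>x\<in>set xs. hdeg G (g x)) + d (length xs))"
    by (simp only: w(2))
qed

text \<open>The index \<open>0\<close> stands for the inserted element \<open>b\<close>.\<close>

lemma super_antisym_insert:
  assumes ys: "sorted_wrt (<) ys" and pos: "\<forall>y\<in>set ys. 0 < y"
    and b: "b \<in> G D" and i: "i = Suc (length ys)"
  shows "super_antisym scale G m i (b # map g ys) =
    (\<Sum>k<i. \<Sum>y\<in>permutations_of_set (set ys).
      scale ((-1) powi (anti_exp g y + (\<Sum>x\<in>set (take k y). 1 + hdeg G (g x) * D)))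
        (m i (map g (take k y) @ b # map g (drop k y))))"
proof -
  let ?g = "g(0 := b)"
  have zero: "0 \<notin> set ys" using pos by auto
  have map: "map ?g u = map g u" if "0 \<notin> set u" for u
    using that by (intro map_cong) auto
  have card: "card (set ys) = length ys" using ys by (simp add: distinct_card strict_sorted_iff)
  have "super_antisym scale G m i (b # map g ys) = super_antisym scale G m (length (0 # ys)) (map ?g (0 # ys))"
    unfolding list.map map[OF zero] i by (simp only: fun_upd_same length_Cons)
  also have "\<dots> = (\<Sum>w\<in>permutations_of_set (insert 0 (set ys)). scale ((-1) powi anti_exp ?g w) (m i (map ?g w)))"
    unfolding i by (subst super_antisym_words) (use ys pos in simp_all)
  also have "\<dots> = (\<Sum>k<i. \<Sum>y\<in>permutations_of_set (set ys).
      scale ((-1) powi anti_exp ?g (take k y @ 0 # drop k y)) (m i (map ?g (take k y @ 0 # drop k y))))"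
    using sum_words_insert[OF finite_set zero, where F = "\<lambda>w. scale ((-1) powi anti_exp ?g w) (m i (map ?g w))"]
    unfolding i card .
  also have "\<dots> = (\<Sum>k<i. \<Sum>y\<in>permutations_of_set (set ys).
      scale ((-1) powi (anti_exp g y + (\<Sum>x\<in>set (take k y). 1 + hdeg G (g x) * D)))
        (m i (map g (take k y) @ b # map g (drop k y))))"
  proof (intro sum.cong refl)
    fix k y assume k: "k \<in> {..<i}" and "y \<in> permutations_of_set (set ys)"
    then have y: "distinct y" "set y = set ys" by (auto dest: permutations_of_setD)
    then have len: "length y = length ys" using card by (metis distinct_card)
    have nz: "0 \<notin> set (take k y)" "0 \<notin> set (drop k y)" "0 \<notin> set y"
      using zero y by (auto dest: in_set_takeD in_set_dropD)
    have m: "map ?g (take k y @ 0 # drop k y) = map g (take k y) @ b # map g (drop k y)"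
      by (simp only: map_append list.map map[OF nz(1)] map[OF nz(2)] fun_upd_same)
    show "scale ((-1) powi anti_exp ?g (take k y @ 0 # drop k y)) (m i (map ?g (take k y @ 0 # drop k y))) =
      scale ((-1) powi (anti_exp g y + (\<Sum>x\<in>set (take k y). 1 + hdeg G (g x) * D)))
        (m i (map g (take k y) @ b # map g (drop k y)))"
    \<comment> \<open>For b = 0 the exponents may disagree, since \<open>hdeg G b\<close> is then 0
      and not D, but both sides vanish by linearity in the slot of b.\<close>
    proof (cases "b = 0")
      case True
      have "m i (map g (take k y) @ b # map g (drop k y)) = 0"
        unfolding True using k i len by (intro map_slot_zero) auto
      then show ?thesis unfolding m by simp
    next
      case False
      have "(\<Sum>x\<in>set (take k y). 1 + hdeg G (?g x) * hdeg G (?g 0)) =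
          (\<Sum>x\<in>set (take k y). 1 + hdeg G (g x) * D)"
        using nz hdeg_eq[OF b False] by (intro sum.cong) auto
      moreover have "anti_exp ?g y = anti_exp g y"
        using nz(3) by (intro inv_sum_cong) auto
      moreover have "anti_exp ?g (take k y @ 0 # drop k y) = anti_exp ?g y
          + (\<Sum>x\<in>set (take k y). 1 + hdeg G (?g x) * hdeg G (?g 0))"
        using inv_sum_insert_least[of "take k y" "drop k y" 0 "\<lambda>x y. 1 + hdeg G (?g x) * hdeg G (?g y)"] y pos
        unfolding append_take_drop_id by blast
      ultimately show ?thesis unfolding m by (simp only:)
    qed
  qed
  finally show ?thesis .
qed

end

section \<open>Matching the terms of the two expansions\<close>

lemma sum_swap3:
  "(\<Sum>k\<in>A. \<Sum>y\<in>B. \<Sum>v\<in>C. f k y v) = (\<Sum>v\<in>C. \<Sum>y\<in>B. \<Sum>k\<in>A. f k y v)"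
proof -
  have "(\<Sum>k\<in>A. \<Sum>y\<in>B. \<Sum>v\<in>C. f k y v) = (\<Sum>k\<in>A. \<Sum>v\<in>C. \<Sum>y\<in>B. f k y v)"
    by (intro sum.cong refl sum.swap)
  also have "\<dots> = (\<Sum>v\<in>C. \<Sum>k\<in>A. \<Sum>y\<in>B. f k y v)"
    by (rule sum.swap)
  also have "\<dots> = (\<Sum>v\<in>C. \<Sum>y\<in>B. \<Sum>k\<in>A. f k y v)"
    by (intro sum.cong refl sum.swap)
  finally show ?thesis .
qed

lemma minus_one_powi_add: "(-1 :: complex) powi (a + b) = (-1) powi a * (-1) powi b"
  by (simp add: power_int_add)

context graded_multilinear_maps
begin

lemma tilde_conv_susp_weight:
  assumes "length as = k"
  shows "tilde scale G m k as = scale ((-1) powi susp_weight (map (sdeg G) as)) (m k as)"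
proof -
  have "susp_weight (map (sdeg G) as) = (\<Sum>t<k. int (k - Suc t) * sdeg G (as ! t))"
    using assms susp_weight_conv_nth[of "map (sdeg G) as"] by simp
  then show ?thesis by (simp add: tilde_def)
qed

text \<open>The outer weight sees the inner value only through its suspended degree D - 1, and the
  inner sign leaves its slot by linearity, so both modifications become one scalar.\<close>

lemma tilde_nested:
  fixes g :: "nat \<Rightarrow> 'a"
  defines "s \<equiv> \<lambda>x. sdeg G (g x)"
  assumes v: "distinct v" "v \<noteq> []" "length v = j" and hom: "\<forall>x\<in>set v. homogeneous G (g x)"
    and i: "i = Suc (length u + length z)" and D: "D = (\<Sum>x\<in>set v. hdeg G (g x)) + d j"
  shows "tilde scale G m i (map g u @ [tilde scale G m j (map g v)] @ map g z) =
    scale ((-1) powi (susp_weight (map s u @ (D - 1) # map s z) + susp_weight (map s v)))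
      (m i (map g u @ m j (map g v) # map g z))"
proof -
  let ?c = "(-1 :: complex) powi susp_weight (map s v)"
  define b where "b = tilde scale G m j (map g v)"
  have b: "b = scale ?c (m j (map g v))"
    unfolding b_def using v by (subst tilde_conv_susp_weight) (simp_all add: s_def comp_def)
  have bD: "b \<in> G D"
    unfolding b D using map_in_component[of v j g] v hom
    by (intro subspace_scale subspace_component) auto
  have M: "m i (map g u @ b # map g z) = scale ?c (m i (map g u @ m j (map g v) # map g z))"
    unfolding b using i by (intro map_slot_scale) simp
  have t: "tilde scale G m i (map g u @ [b] @ map g z) =
      scale ((-1) powi susp_weight (map s u @ sdeg G b # map s z)) (m i (map g u @ b # map g z))"
    using i by (subst tilde_conv_susp_weight) (simp_all add: s_def comp_def)
  show ?thesis
  \<comment> \<open>A zero inner value has \<open>sdeg\<close> -1 instead of D - 1. Both sides are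
    zero in this case; for the right-hand side this follows from \<open>M\<close>, whose scalar is a
    sign and hence nonzero.\<close>
  proof (cases "b = 0")
    case True
    have "m i (map g u @ b # map g z) = 0"
      unfolding True using i by (intro map_slot_zero) simp
    moreover from this M have "m i (map g u @ m j (map g v) # map g z) = 0"
      by simp
    ultimately show ?thesis using t unfolding b_def[symmetric] by simp
  next
    case False
    show ?thesis
      unfolding b_def[symmetric] t M sdeg_eq[OF bD False] by (simp add: minus_one_powi_add)
  qed
qed

lemma exponent_parity:
  fixes g :: "nat \<Rightarrow> 'a"
  defines "s \<equiv> \<lambda>x. sdeg G (g x)"
  assumes "distinct (u @ v @ z)" "sorted_wrt (<) xs" "set (u @ v @ z) = set xs"
    "length v = j" "i = Suc (length u + length z)" "j \<ge> 1"
    "D = (\<Sum>x\<in>set v. hdeg G (g x)) + d j"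
  shows "even (cross_sum (\<lambda>x y. 1 + hdeg G (g x) * hdeg G (g y)) (set v) (set (u @ z)) + int i
      + anti_exp g v + anti_exp g (u @ z) + (\<Sum>x\<in>set u. 1 + hdeg G (g x) * D)
      + (susp_exp g (u @ v @ z) + (\<Sum>x\<in>set u. s x)
        + susp_weight (map s u @ (D - 1) # map s z) + susp_weight (map s v))
      + 1 + susp_weight (map s xs))"
proof -
  have h: "hdeg G a = sdeg G a + 1" for a by (simp add: sdeg_def)
  show ?thesis
    using sign_parity[OF assms(2-6) even_degree[OF assms(7)], of D s] assms(8)
    unfolding h s_def by blast
qed

text \<open>The sign of the unshuffle consists of inversions between its two blocks only, so it
  survives the rearrangements made by l_j and l_i and simply adds to their exponents. What remains
  is bookkeeping of words: y = u z is the word of the outer arguments and \<open>k\<close> the slot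
  of the inner value.\<close>

lemma unshuffle_sum_words:
  fixes g :: "nat \<Rightarrow> 'a"
  assumes xs: "sorted_wrt (<) xs" and pos: "\<forall>x\<in>set xs. 0 < x"
    and hom: "\<forall>x\<in>set xs. homogeneous G (g x)"
    and ij: "1 \<le> i" "1 \<le> j" "i + j = length xs + 1"
  defines "D \<equiv> \<lambda>v. (\<Sum>x\<in>set v. hdeg G (g x)) + d j"
  shows "(\<Sum>\<sigma>\<in>unshuffles j (length xs). scale ((-1) powi (p_sgn G \<sigma> (map g xs) + int i))
      (super_antisym scale G m i (super_antisym scale G m j (take j (permute_list \<sigma> (map g xs)))
        # drop j (permute_list \<sigma> (map g xs))))) =
    (\<Sum>k<i. \<Sum>w\<in>permutations_of_set (set xs).
      let u = take k w; v = take j (drop k w); z = drop (k + j) w in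
      scale ((-1) powi (cross_sum (\<lambda>x y. 1 + hdeg G (g x) * hdeg G (g y)) (set v) (set (u @ z)) + int i
        + anti_exp g v + anti_exp g (u @ z) + (\<Sum>x\<in>set u. 1 + hdeg G (g x) * D v)))
      (m i (map g u @ m j (map g v) # map g z)))"
proof -
  let ?I = "set xs" and ?c = "\<lambda>x y. 1 + hdeg G (g x) * hdeg G (g y)"
  let ?W = "{w. w \<in> permutations_of_set ?I \<and> sorted_wrt (<) (take j w) \<and> sorted_wrt (<) (drop j w)}"
  define F where "F k v y = scale ((-1) powi (cross_sum ?c (set v) (set y) + int i
        + anti_exp g v + anti_exp g y + (\<Sum>x\<in>set (take k y). 1 + hdeg G (g x) * D v)))
      (m i (map g (take k y) @ m j (map g v) # map g (drop k y)))" for k v y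
  define T where "T w = scale ((-1) powi (anti_exp g w + int i))
      (super_antisym scale G m i (super_antisym scale G m j (map g (take j w)) # map g (drop j w)))" for w
  have dist: "distinct xs" using xs by (simp add: strict_sorted_iff)
  have len: "length w = length xs" if "w \<in> permutations_of_set ?I" for w
    using that dist by (metis distinct_card permutations_of_setD)
  have T: "T w = (\<Sum>v\<in>permutations_of_set (set (take j w)). \<Sum>y\<in>permutations_of_set (set (drop j w)). \<Sum>k<i. F k v y)"
    if w: "w \<in> ?W" for w
  proof -
    let ?v = "take j w" and ?y = "drop j w"
    have wI: "w \<in> permutations_of_set ?I" and sv: "sorted_wrt (<) ?v" and sy: "sorted_wrt (<) ?y"
      using w by auto
    have dw: "distinct w" "set w = ?I" using wI by (auto dest: permutations_of_setD)
    have lv: "length ?v = j" and ly: "i = Suc (length ?y)"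
      using len[OF wI] ij by auto
    have vne: "?v \<noteq> []" using lv ij by auto
    have hv: "\<forall>x\<in>set ?v. homogeneous G (g x)"
      using hom dw by (auto dest: in_set_takeD)
    have py: "\<forall>x\<in>set ?y. 0 < x"
      using pos dw by (auto dest: in_set_dropD)
    define b where "b = super_antisym scale G m j (map g ?v)"
    have bD: "b \<in> G (D ?v)"
      using super_antisym_in_component[where g = g, OF sv vne hv] unfolding lv b_def D_def by blast
    have b: "b = (\<Sum>v\<in>permutations_of_set (set ?v). scale ((-1) powi anti_exp g v) (m j (map g v)))"
      using super_antisym_words[OF sv, of g] unfolding lv b_def .
    \<comment> \<open>Both blocks of an unshuffle are increasing, so neither has inversions of its
      own.\<close>
    have e: "anti_exp g w = cross_sum ?c (set ?v) (set ?y)"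
      using inv_sum_append[of ?v ?y ?c] dw inv_sum_sorted[OF sv, of ?c] inv_sum_sorted[OF sy, of ?c] by simp
    have "T w = scale ((-1) powi (anti_exp g w + int i)) (\<Sum>k<i. \<Sum>y\<in>permutations_of_set (set ?y).
      scale ((-1) powi (anti_exp g y + (\<Sum>x\<in>set (take k y). 1 + hdeg G (g x) * D ?v)))
        (m i (map g (take k y) @ b # map g (drop k y))))"
      unfolding T_def b_def[symmetric] super_antisym_insert[OF sy py bD ly] ..
    also have "\<dots> = (\<Sum>k<i. \<Sum>y\<in>permutations_of_set (set ?y). \<Sum>v\<in>permutations_of_set (set ?v). F k v y)"
      unfolding scale_sum_right
    proof (intro sum.cong refl)
      fix k y assume k: "k \<in> {..<i}" and y: "y \<in> permutations_of_set (set ?y)"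
      have ly': "length y = length ?y"
        using y dw by (metis distinct_card distinct_drop permutations_of_setD)
      have "m i (map g (take k y) @ b # map g (drop k y)) = (\<Sum>v\<in>permutations_of_set (set ?v).
          scale ((-1) powi anti_exp g v) (m i (map g (take k y) @ m j (map g v) # map g (drop k y))))"
        unfolding b using k ly ly' by (intro map_slot_sum) auto
      moreover have "F k v y = scale ((-1) powi (anti_exp g w + int i))
          (scale ((-1) powi (anti_exp g y + (\<Sum>x\<in>set (take k y). 1 + hdeg G (g x) * D ?v)))
          (scale ((-1) powi anti_exp g v) (m i (map g (take k y) @ m j (map g v) # map g (drop k y)))))"
        if "v \<in> permutations_of_set (set ?v)" for v
      proof -
        have sets: "set v = set ?v" "set y = set ?y" using that y by (auto dest: permutations_of_setD)
        \<comment> \<open>The outer sign was computed for the increasing block, yet the same degree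
          serves every rearrangement of it.\<close>
        have "D v = D ?v" unfolding D_def sets ..
        then show ?thesis unfolding F_def e sets scale_scale minus_one_powi_add
          by (simp only: mult.assoc mult.commute mult.left_commute)
      qed
      ultimately show "scale ((-1) powi (anti_exp g w + int i))
          (scale ((-1) powi (anti_exp g y + (\<Sum>x\<in>set (take k y). 1 + hdeg G (g x) * D ?v)))
          (m i (map g (take k y) @ b # map g (drop k y)))) = (\<Sum>v\<in>permutations_of_set (set ?v). F k v y)"
        by (simp only: scale_sum_right cong: sum.cong)
    qed
    also have "\<dots> = (\<Sum>v\<in>permutations_of_set (set ?v). \<Sum>y\<in>permutations_of_set (set ?y). \<Sum>k<i. F k v y)"
      by (rule sum_swap3)
    finally show ?thesis .
  qed
  have "(\<Sum>\<sigma>\<in>unshuffles j (length xs). scale ((-1) powi (p_sgn G \<sigma> (map g xs) + int i))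
      (super_antisym scale G m i (super_antisym scale G m j (take j (permute_list \<sigma> (map g xs)))
        # drop j (permute_list \<sigma> (map g xs))))) = (\<Sum>\<sigma>\<in>unshuffles j (length xs). T (permute_list \<sigma> xs))"
    unfolding T_def
    by (rule sum.cong) (auto simp: unshuffles_def p_sgn_word[OF _ xs] permute_list_map take_map drop_map)
  also have "\<dots> = (\<Sum>w\<in>?W. T w)"
    using ij by (intro sum_unshuffles[OF xs]) simp
  also have "\<dots> = (\<Sum>w\<in>?W. \<Sum>v\<in>permutations_of_set (set (take j w)).
      \<Sum>y\<in>permutations_of_set (set (drop j w)). \<Sum>k<i. F k v y)"
    by (rule sum.cong[OF refl T])
  also have "\<dots> = (\<Sum>w\<in>permutations_of_set ?I. \<Sum>k<i. F k (take j w) (drop j w))"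
    by (rule sum_unshuffle_words[OF finite_set, where F = "\<lambda>v y. \<Sum>k<i. F k v y"])
  also have "\<dots> = (\<Sum>k<i. \<Sum>w\<in>permutations_of_set ?I. F k (take j w) (drop j w))"
    by (rule sum.swap)
  \<comment> \<open>The word now reads u v z with u of length \<open>k\<close>, the order in which
    the composition in (ii) uses its arguments.\<close>
  also have "\<dots> = (\<Sum>k<i. \<Sum>w\<in>permutations_of_set ?I. F k (take j (drop k w)) (take k w @ drop (k + j) w))"
    using dist ij by (intro sum.cong refl sum_words_rotate) (auto simp: distinct_card)
  also have "\<dots> = (\<Sum>k<i. \<Sum>w\<in>permutations_of_set ?I.
      let u = take k w; v = take j (drop k w); z = drop (k + j) w in
      scale ((-1) powi (cross_sum ?c (set v) (set (u @ z)) + int i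
        + anti_exp g v + anti_exp g (u @ z) + (\<Sum>x\<in>set u. 1 + hdeg G (g x) * D v)))
      (m i (map g u @ m j (map g v) # map g z)))"
  proof (intro sum.cong refl)
    fix k w assume k: "k \<in> {..<i}" and w: "w \<in> permutations_of_set ?I"
    have "length (take k w) = k" using k len[OF w] ij by auto
    then have "take k (take k w @ drop (k + j) w) = take k w" "drop k (take k w @ drop (k + j) w) = drop (k + j) w"
      by simp_all
    then show "F k (take j (drop k w)) (take k w @ drop (k + j) w) =
      (let u = take k w; v = take j (drop k w); z = drop (k + j) w in
      scale ((-1) powi (cross_sum ?c (set v) (set (u @ z)) + int i
        + anti_exp g v + anti_exp g (u @ z) + (\<Sum>x\<in>set u. 1 + hdeg G (g x) * D v)))
      (m i (map g u @ m j (map g v) # map g z)))"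
      unfolding F_def Let_def by (simp only:)
  qed
  finally show ?thesis .
qed

text \<open>The summands agree individually for each slot and word. The discrepancy of signs
  involves neither of them, nor i and j, which is why it stands in front of the sum.\<close>

lemma unshuffle_sum_eq_self_comp_term:
  fixes g :: "nat \<Rightarrow> 'a"
  assumes xs: "sorted_wrt (<) xs" and pos: "\<forall>x\<in>set xs. 0 < x"
    and hom: "\<forall>x\<in>set xs. homogeneous G (g x)"
    and ij: "1 \<le> i" "1 \<le> j" "i + j = length xs + 1"
  shows "(\<Sum>\<sigma>\<in>unshuffles j (length xs). scale ((-1) powi (p_sgn G \<sigma> (map g xs) + int i))
      (super_antisym scale G m i (super_antisym scale G m j (take j (permute_list \<sigma> (map g xs)))
        # drop j (permute_list \<sigma> (map g xs))))) =
    scale ((-1) powi (1 + susp_weight (map (sdeg G) (map g xs))))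
      (\<Sum>k<i. \<Sum>w\<in>permutations_of_set (set xs). scale ((-1) powi susp_exp g w)
        (scale ((-1) powi (\<Sum>t<k. sdeg G (map g w ! t)))
          (tilde scale G m i (take k (map g w) @ [tilde scale G m j (take j (drop k (map g w)))]
            @ drop (k + j) (map g w)))))"
proof (rule trans[OF unshuffle_sum_words[where g = g, OF assms]], unfold scale_sum_right, intro sum.cong refl, unfold Let_def)
  fix k w assume k: "k \<in> {..<i}" and w: "w \<in> permutations_of_set (set xs)"
  define s where "s = (\<lambda>x. sdeg G (g x))"
  define u v z where uvz: "u = take k w" "v = take j (drop k w)" "z = drop (k + j) w"
  define D where "D = (\<Sum>x\<in>set v. hdeg G (g x)) + d j"
  have dw: "distinct w" "set w = set xs" using w by (auto dest: permutations_of_setD)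
  have "length w = length xs"
    using dw xs by (metis distinct_card strict_sorted_iff)
  then have lens: "length u = k" "length v = j" "i = Suc (length u + length z)"
    using k ij by (auto simp: uvz)
  have split: "w = u @ v @ z" unfolding uvz by (metis add.commute append_take_drop_id drop_drop)
  have vne: "v \<noteq> []" using lens ij by auto
  have dv: "distinct v" using dw split by auto
  have hv: "\<forall>x\<in>set v. homogeneous G (g x)"
    using hom dw split by auto
  have "(\<Sum>t<k. sdeg G (map g w ! t)) = (\<Sum>t<k. s (u ! t))"
    using lens by (intro sum.cong refl) (auto simp: split nth_append s_def)
  also have "\<dots> = (\<Sum>x\<in>set u. s x)"
    using dw split lens by (intro sum.reindex_bij_betw bij_betw_nth) auto
  finally have su: "(\<Sum>t<k. sdeg G (map g w ! t)) = (\<Sum>x\<in>set u. s x)" .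
  have tw: "take k (map g w) = map g u" "take j (drop k (map g w)) = map g v" "drop (k + j) (map g w) = map g z"
    by (simp_all add: uvz take_map drop_map)
  let ?A = "cross_sum (\<lambda>x y. 1 + hdeg G (g x) * hdeg G (g y)) (set v) (set (u @ z)) + int i
        + anti_exp g v + anti_exp g (u @ z) + (\<Sum>x\<in>set u. 1 + hdeg G (g x) * D)"
  let ?B = "susp_exp g w + (\<Sum>x\<in>set u. s x)
        + susp_weight (map s u @ (D - 1) # map s z) + susp_weight (map s v)"
  have "even (?A + ?B + 1 + susp_weight (map s xs))"
    using exponent_parity[where u = u and v = v and z = z and xs = xs and j = j and i = i and D = D and g = g] dw split lens xs ij unfolding s_def D_def by simp
  then have "even (?A + (1 + susp_weight (map (sdeg G) (map g xs)) + ?B))"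
    by (simp add: s_def comp_def add_ac)
  then have sgn: "(-1 :: complex) powi ?A = (-1) powi (1 + susp_weight (map (sdeg G) (map g xs)) + ?B)"
    by (rule minus_one_powi_cong)
  show "scale ((-1) powi (cross_sum (\<lambda>x y. 1 + hdeg G (g x) * hdeg G (g y)) (set (take j (drop k w))) (set (take k w @ drop (k + j) w)) + int i
        + anti_exp g (take j (drop k w)) + anti_exp g (take k w @ drop (k + j) w)
        + (\<Sum>x\<in>set (take k w). 1 + hdeg G (g x) * ((\<Sum>x\<in>set (take j (drop k w)). hdeg G (g x)) + d j))))
      (m i (map g (take k w) @ m j (map g (take j (drop k w))) # map g (drop (k + j) w))) =
    scale ((-1) powi (1 + susp_weight (map (sdeg G) (map g xs)))) (scale ((-1) powi susp_exp g w)
        (scale ((-1) powi (\<Sum>t<k. sdeg G (map g w ! t)))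
          (tilde scale G m i (take k (map g w) @ [tilde scale G m j (take j (drop k (map g w)))]
            @ drop (k + j) (map g w)))))"
    unfolding tw su tilde_nested[where g = g, OF dv vne lens(2) hv lens(3) D_def] uvz[symmetric] D_def[symmetric] sgn
      s_def[symmetric]
    by (simp only: scale_scale minus_one_powi_add mult.assoc)
qed

lemma unshuffle_sum_eq_susp_sym:
  assumes len: "length as = n" and hom: "\<forall>a\<in>set as. homogeneous G a"
  shows "(\<Sum>(i, j) | 1 \<le> i \<and> 1 \<le> j \<and> i + j = n + 1. \<Sum>\<sigma>\<in>unshuffles j n.
      scale ((-1) powi (p_sgn G \<sigma> as + int i))
        (super_antisym scale G m i
          (super_antisym scale G m j (take j (permute_list \<sigma> as)) # drop j (permute_list \<sigma> as)))) =
    scale ((-1) powi (1 + susp_weight (map (sdeg G) as)))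
      (susp_sym scale G (self_comp scale G (tilde scale G m)) n as)"
proof -
  \<comment> \<open>The indices start at 1 to keep 0 free as the least letter for the inner value;
    \<open>g\<close> undoes this shift.\<close>
  define xs where "xs = [1..<Suc n]"
  define g where "g x = as ! (x - 1)" for x
  let ?P = "permutations_of_set (set xs)"
  let ?S = "{(i, j). 1 \<le> i \<and> 1 \<le> j \<and> i + j = n + 1}"
  have xs: "sorted_wrt (<) xs" "length xs = n" "\<forall>x\<in>set xs. 0 < x"
    by (auto simp: xs_def simp del: upt_Suc)
  have as: "map g xs = as"
    using len by (intro nth_equalityI) (auto simp: xs_def g_def nth_upt simp del: upt_Suc)
  have hg: "\<forall>x\<in>set xs. homogeneous G (g x)"
    using hom unfolding as[symmetric] by simp
  have "susp_sym scale G (self_comp scale G (tilde scale G m)) n as =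
      (\<Sum>w\<in>?P. scale ((-1) powi susp_exp g w) (self_comp scale G (tilde scale G m) n (map g w)))"
    using susp_sym_words[OF xs(1), of _ g] unfolding as xs(2) .
  also have "\<dots> = (\<Sum>w\<in>?P. \<Sum>(i, j)\<in>?S. \<Sum>k<i. scale ((-1) powi susp_exp g w)
        (scale ((-1) powi (\<Sum>t<k. sdeg G (map g w ! t)))
          (tilde scale G m i (take k (map g w) @ [tilde scale G m j (take j (drop k (map g w)))]
            @ drop (k + j) (map g w)))))"
    unfolding self_comp_def scale_sum_right split_def ..
  also have "\<dots> = (\<Sum>p\<in>?S. \<Sum>w\<in>?P. case p of (i, j) \<Rightarrow> \<Sum>k<i. scale ((-1) powi susp_exp g w)
        (scale ((-1) powi (\<Sum>t<k. sdeg G (map g w ! t)))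
          (tilde scale G m i (take k (map g w) @ [tilde scale G m j (take j (drop k (map g w)))]
            @ drop (k + j) (map g w)))))"
    by (rule sum.swap)
  also have "\<dots> = (\<Sum>(i, j)\<in>?S. \<Sum>k<i. \<Sum>w\<in>?P. scale ((-1) powi susp_exp g w)
        (scale ((-1) powi (\<Sum>t<k. sdeg G (map g w ! t)))
          (tilde scale G m i (take k (map g w) @ [tilde scale G m j (take j (drop k (map g w)))]
            @ drop (k + j) (map g w)))))"
    unfolding split_def by (intro sum.cong refl sum.swap)
  finally have R: "susp_sym scale G (self_comp scale G (tilde scale G m)) n as = \<dots>" .
  show ?thesis
    unfolding R scale_sum_right[of _ _ ?S]
  proof (rule sum.cong[OF refl], clarify)
    fix i j :: nat assume "1 \<le> i" "1 \<le> j" "i + j = n + 1"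
    then show "(\<Sum>\<sigma>\<in>unshuffles j n. scale ((-1) powi (p_sgn G \<sigma> as + int i))
        (super_antisym scale G m i
          (super_antisym scale G m j (take j (permute_list \<sigma> as)) # drop j (permute_list \<sigma> as)))) =
      scale ((-1) powi (1 + susp_weight (map (sdeg G) as)))
        (\<Sum>k<i. \<Sum>w\<in>?P. scale ((-1) powi susp_exp g w)
        (scale ((-1) powi (\<Sum>t<k. sdeg G (map g w ! t)))
          (tilde scale G m i (take k (map g w) @ [tilde scale G m j (take j (drop k (map g w)))]
            @ drop (k + j) (map g w)))))"
      using unshuffle_sum_eq_self_comp_term[where g = g, OF xs(1,3) hg, of i j] unfolding as xs(2) by blast
  qed
qed

end

theorem theorem2:
  fixes scale :: "complex \<Rightarrow> 'a::ab_group_add \<Rightarrow> 'a"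
    and G :: "int \<Rightarrow> 'a set"
    and m :: "nat \<Rightarrow> 'a list \<Rightarrow> 'a"
    and d :: "nat \<Rightarrow> int"
  assumes graded: "graded_vector_space scale G"
    and multilinear: "\<And>k. k \<ge> 1 \<Longrightarrow> multilinear scale k (m k)"
    and degree: "\<And>k. k \<ge> 1 \<Longrightarrow> has_super_degree G k (m k) (d k)"
    and parity: "\<And>k. k \<ge> 1 \<Longrightarrow> (-1 :: complex) powi d k = (-1) ^ k"
  shows
    "(\<forall>n\<ge>1. \<forall>as. length as = n \<and> (\<forall>a\<in>set as. homogeneous G a) \<longrightarrow>
        (\<Sum>(i, j) | 1 \<le> i \<and> 1 \<le> j \<and> i + j = n + 1.
           \<Sum>\<sigma>\<in>unshuffles j n.
             scale ((-1) powi (p_sgn G \<sigma> as + int i))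
               (super_antisym scale G m i
                 (super_antisym scale G m j (take j (permute_list \<sigma> as)) # drop j (permute_list \<sigma> as)))) = 0)
     \<longleftrightarrow>
     (\<forall>n\<ge>1. \<forall>as. length as = n \<and> (\<forall>a\<in>set as. homogeneous G a) \<longrightarrow>
        susp_sym scale G (self_comp scale G (tilde scale G m)) n as = 0)"
proof -
  interpret graded_vector_space scale G by (rule graded)
  interpret graded_multilinear_maps scale G m d
    using multilinear degree parity by unfold_locales
  show ?thesis
  proof (intro iffI allI impI; elim conjE)
    fix n as
    assume *: "\<forall>n\<ge>1. \<forall>as. length as = n \<and> (\<forall>a\<in>set as. homogeneous G a) \<longrightarrow>
        (\<Sum>(i, j) | 1 \<le> i \<and> 1 \<le> j \<and> i + j = n + 1.
           \<Sum>\<sigma>\<in>unshuffles j n.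
             scale ((-1) powi (p_sgn G \<sigma> as + int i))
               (super_antisym scale G m i
                 (super_antisym scale G m j (take j (permute_list \<sigma> as)) # drop j (permute_list \<sigma> as)))) = 0"
      and n: "1 \<le> n" and as: "length as = n" "\<forall>a\<in>set as. homogeneous G a"
    \<comment> \<open>The scalar in front is a sign, hence invertible, so (ii) follows for this very
      tuple from (i) for the same tuple.\<close>
    have "scale ((-1) powi (1 + susp_weight (map (sdeg G) as)))
        (susp_sym scale G (self_comp scale G (tilde scale G m)) n as) = 0"
      by (subst unshuffle_sum_eq_susp_sym[OF as(1) as(2), symmetric]) (use * n as in blast)+
    then show "susp_sym scale G (self_comp scale G (tilde scale G m)) n as = 0"
      by simp
  next
    fix n as
    assume *: "\<forall>n\<ge>1. \<forall>as. length as = n \<and> (\<forall>a\<in>set as. homogeneous G a) \<longrightarrow>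
        susp_sym scale G (self_comp scale G (tilde scale G m)) n as = 0"
      and n: "1 \<le> n" and as: "length as = n" "\<forall>a\<in>set as. homogeneous G a"
    show "(\<Sum>(i, j) | 1 \<le> i \<and> 1 \<le> j \<and> i + j = n + 1.
           \<Sum>\<sigma>\<in>unshuffles j n.
             scale ((-1) powi (p_sgn G \<sigma> as + int i))
               (super_antisym scale G m i
                 (super_antisym scale G m j (take j (permute_list \<sigma> as)) # drop j (permute_list \<sigma> as)))) = 0"
      using * n as by (simp only: unshuffle_sum_eq_susp_sym[OF as(1) as(2)] scale_zero_right)
  qed
qed

end
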